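(* Let $\Gamma\subset\operatorname{PSL}(2,\mathbb{R})$ be a Fuchsian group with signature $(0;n_1,\ldots,n_r)$, with compact quotient Riemann surface $\hat X=\Gamma\backslash\mathbb{H}^*$ (of genus $0$). Let $\tau_1,\ldots,\tau_r$ be the inequivalent vertices (elliptic points or cusps) of the fundamental domain of $\Gamma$, of orders $n_1,\ldots,n_r$ respectively, and let $w(\tau)$ be a Hauptmodul of $\hat X$. Let $k\ge 4$ be an even integer and put $$a_i=\Big\lfloor \frac{k}{2}\Big(1-\frac{1}{n_i}\Big)\Big\rfloor\quad (i=1,\ldots,r),\qquad d=1-k+\sum_{i=1}^r a_i .$$ Let $w_i=w(\tau_i)\in\mathbb{C}\cup\{\infty\}$ for $i=1,\ldots,r$, and for each integer $j$ with $0\le j\le d-1$ define $$h_j(\tau)=\frac{\big(w'(\tau)\big)^{k/2}\,\big(w(\tau)\big)^j}{\displaystyle\prod_{1\le i\le r,\; w_i\neq\infty}\big(w(\tau)-w_i\big)^{a_i}},\qquad \tau\in\mathbb{H}.$$ Then $h_j$ is holomorphic on $\mathbb{H}$ for every $j=0,\ldots,d-1$.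
   Context: $\mathbb{H}=\{\tau\in\mathbb{C}:\operatorname{Im}\tau>0\}$, and $\operatorname{PSL}(2,\mathbb{R})=\operatorname{SL}(2,\mathbb{R})/\{\pm I_2\}$ acts on $\mathbb{H}$ and on $\mathbb{R}\cup\{\infty\}$ by $\gamma\cdot\tau=\frac{a\tau+b}{c\tau+d}$ for $\gamma=\begin{pmatrix}a&b\\c&d\end{pmatrix}$ (in matrix entries, $d$ denotes an entry and not the integer $d$ of the claim). A Fuchsian group is a discrete subgroup of $\operatorname{PSL}(2,\mathbb{R})$. An element $\gamma$ is elliptic if $|\operatorname{tr}\gamma|<2$ and parabolic if $|\operatorname{tr}\gamma|=2$ (and $\gamma$ is not the identity). An elliptic point of $\Gamma$ is a point of $\mathbb{H}$ fixed by an elliptic element of $\Gamma$; a cusp of $\Gamma$ is a point of $\mathbb{R}\cup\{\infty\}$ fixed by a parabolic element of $\Gamma$. $\mathbb{H}^*$ is the union of $\mathbb{H}$ and the set of cusps of $\Gamma$, and $\hat X=\Gamma\backslash\mathbb{H}^*$ is the quotient Riemann surface, assumed compact. $\Gamma$ has signature $(g;n_1,\ldots,n_r)$ if $\hat X$ has genus $g$ and $\tau_1,\ldots,\tau_r$ is a complete list of representatives of the $\Gamma$-inequivalent elliptic points and cusps, with orders $n_1,\ldots,n_r$. The order of an elliptic point is the order of its (finite cyclic) stabilizer in $\Gamma\subset\operatorname{PSL}(2,\mathbb{R})$; the order of a cusp is $\infty$, with the convention $1/\infty=0$. A Hauptmodul of $\hat X$ (when $\hat X$ has genus $0$) is a $\Gamma$-invariant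 meromorphic function $w$ on $\mathbb{H}$, extending to the cusps, which induces an isomorphism of Riemann surfaces $\hat X\to\mathbb{C}\cup\{\infty\}$. The value $w(\tau_i)$ at a cusp $\tau_i$ is the value of this extension. A priori $h_j$ is a meromorphic function on $\mathbb{H}$; "holomorphic on $\mathbb{H}$" means that it has no poles in $\mathbb{H}$, i.e. all its isolated singularities in $\mathbb{H}$ are removable. *)

theory Defs
  imports
    "HOL-Complex_Analysis.Complex_Analysis"
    "HOL-Homology.Homology"
    "HOL-Algebra.Group_Action"
    "HOL-Library.Extended_Nat"
begin

section \<open>The group PSL(2,R)\<close>

definition SL2R :: "(real^2^2) monoid" where
  "SL2R = \<lparr>carrier = {A. det A = 1}, monoid.mult = (**), one = mat 1\<rparr>"

text \<open>Elements of the quotient are the cosets \<open>{A, - A}\<close>.\<close>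

definition PSL2R :: "(real^2^2) set monoid" where
  "PSL2R = SL2R Mod {mat 1, - mat 1}"

lemma group_SL2R: "group SL2R"
proof (rule groupI)
  fix x assume x: "x \<in> carrier SL2R"
  then have "invertible x" by (simp add: SL2R_def invertible_det_nz)
  then obtain y where y: "x ** y = mat 1" "y ** x = mat 1"
    unfolding invertible_def by blast
  have "det (y ** x) = 1" using y by simp
  then have "det y = 1" using x by (simp add: det_mul SL2R_def)
  with y show "\<exists>y\<in>carrier SL2R. y \<otimes>\<^bsub>SL2R\<^esub> x = \<one>\<^bsub>SL2R\<^esub>"
    by (auto simp: SL2R_def)
qed (auto simp: SL2R_def det_mul matrix_mul_assoc)

lemma coset_SL2R: "{mat 1, - mat 1} #>\<^bsub>SL2R\<^esub> A = {A, - A}"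
proof -
  have "(- mat 1) ** A = - A" for A :: "real^2^2"
    by (simp add: vec_eq_iff matrix_matrix_mult_def mat_def sum_2 forall_2)
  then show ?thesis by (auto simp: r_coset_def SL2R_def)
qed

lemma normal_pm_one: "{mat 1, - mat 1} \<lhd> SL2R"
proof -
  interpret group SL2R by (rule group_SL2R)
  have m: "(- mat 1) ** A = - A" "A ** (- mat 1) = - A" for A :: "real^2^2"
    by (simp_all add: vec_eq_iff matrix_matrix_mult_def mat_def sum_2 forall_2)
  have d: "det (- mat 1 :: real^2^2) = 1" by (simp add: det_2 mat_def)
  have dI: "det (mat 1 :: real^2^2) = 1" by simp
  have iv: "inv\<^bsub>SL2R\<^esub> (- mat 1) = - mat 1"
    by (rule inv_equality) (use d m in \<open>auto simp: SL2R_def\<close>)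
  have "subgroup {mat 1, - mat 1} SL2R"
  proof (rule subgroupI)
    show "{mat 1, - mat 1} \<subseteq> carrier SL2R" using d by (auto simp: SL2R_def)
    fix a assume a: "a \<in> {mat 1, - mat 1 :: real^2^2}"
    show "inv\<^bsub>SL2R\<^esub> a \<in> {mat 1, - mat 1}"
      using a iv inv_one by (auto simp: SL2R_def)
    fix b assume b: "b \<in> {mat 1, - mat 1 :: real^2^2}"
    show "a \<otimes>\<^bsub>SL2R\<^esub> b \<in> {mat 1, - mat 1}"
      using a b m by (auto simp: SL2R_def)
  qed auto
  then show ?thesis
  proof (rule normalI[rule_format])
    fix x
    show "{mat 1, - mat 1} #>\<^bsub>SL2R\<^esub> x = x <#\<^bsub>SL2R\<^esub> {mat 1, - mat 1}"
      using m by (auto simp: r_coset_def l_coset_def SL2R_def)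
  qed
qed

lemma group_PSL2R: "group PSL2R"
  unfolding PSL2R_def by (rule normal.factorgroup_is_group[OF normal_pm_one])

lemma carrier_PSL2R: "carrier PSL2R = {{A, - A} |A. det A = 1}"
  unfolding PSL2R_def carrier_FactGroup coset_SL2R by (auto simp: SL2R_def)

definition elliptic_elt :: "(real^2^2) set \<Rightarrow> bool" where
  "elliptic_elt \<gamma> \<longleftrightarrow> (\<exists>A\<in>\<gamma>. \<bar>trace A\<bar> < 2)"

definition parabolic_elt :: "(real^2^2) set \<Rightarrow> bool" where
  "parabolic_elt \<gamma> \<longleftrightarrow> (\<exists>A\<in>\<gamma>. \<bar>trace A\<bar> = 2) \<and> \<gamma> \<noteq> \<one>\<^bsub>PSL2R\<^esub>"

definition quotient_topology :: "'a topology \<Rightarrow> ('a \<Rightarrow> 'b) \<Rightarrow> 'b topology" where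
  "quotient_topology X f =
     topology (\<lambda>U. U \<subseteq> f ` topspace X \<and> openin X {x \<in> topspace X. f x \<in> U})"

lemma openin_quotient_topology:
  "openin (quotient_topology X f) U \<longleftrightarrow>
     U \<subseteq> f ` topspace X \<and> openin X {x \<in> topspace X. f x \<in> U}"
proof -
  have "istopology (\<lambda>U. U \<subseteq> f ` topspace X \<and> openin X {x \<in> topspace X. f x \<in> U})"
    unfolding istopology_def
  proof (intro conjI allI impI)
    fix S T
    assume "S \<subseteq> f ` topspace X \<and> openin X {x \<in> topspace X. f x \<in> S}"
      "T \<subseteq> f ` topspace X \<and> openin X {x \<in> topspace X. f x \<in> T}"
    moreover have "{x \<in> topspace X. f x \<in> S \<inter> T} =
        {x \<in> topspace X. f x \<in> S} \<inter> {x \<in> topspace X. f x \<in> T}" by blast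
    ultimately show "S \<inter> T \<subseteq> f ` topspace X" "openin X {x \<in> topspace X. f x \<in> S \<inter> T}"
      by (auto simp: openin_Int)
  next
    fix K
    assume K: "\<forall>S\<in>K. S \<subseteq> f ` topspace X \<and> openin X {x \<in> topspace X. f x \<in> S}"
    then show "\<Union> K \<subseteq> f ` topspace X" by blast
    have "{x \<in> topspace X. f x \<in> \<Union> K} = (\<Union>S\<in>K. {x \<in> topspace X. f x \<in> S})" by blast
    with K show "openin X {x \<in> topspace X. f x \<in> \<Union> K}" by auto
  qed
  then show ?thesis by (simp add: quotient_topology_def topology_inverse')
qed

lemma topspace_quotient_topology [simp]:
  "topspace (quotient_topology X f) = f ` topspace X"
proof
  show "topspace (quotient_topology X f) \<subseteq> f ` topspace X"
    using openin_quotient_topology[of X f "topspace (quotient_topology X f)"] by simp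
  have "{x \<in> topspace X. f x \<in> f ` topspace X} = topspace X" by blast
  then have "openin (quotient_topology X f) (f ` topspace X)"
    by (simp add: openin_quotient_topology)
  then show "f ` topspace X \<subseteq> topspace (quotient_topology X f)"
    by (rule openin_subset)
qed

definition PSL2R_topology :: "(real^2^2) set topology" where
  "PSL2R_topology =
     quotient_topology (top_of_set (carrier SL2R)) (\<lambda>A. {mat 1, - mat 1} #>\<^bsub>SL2R\<^esub> A)"

definition fuchsian :: "(real^2^2) set set \<Rightarrow> bool" where
  "fuchsian \<Gamma> \<longleftrightarrow>
     subgroup \<Gamma> PSL2R \<and> subtopology PSL2R_topology \<Gamma> = discrete_topology \<Gamma>"

section \<open>The action on the upper half plane and its boundary\<close>

text \<open>Points of the Riemann sphere have type \<^typ>\<open>complex option\<close>, with \<^const>\<open>None\<close>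
  the point at infinity.\<close>

definition uhp :: "complex set" where
  "uhp = {\<tau>. Im \<tau> > 0}"

definition boundary :: "complex option set" where
  "boundary = insert None ((\<lambda>x. Some (complex_of_real x)) ` UNIV)"

definition moebius :: "real^2^2 \<Rightarrow> complex option \<Rightarrow> complex option" where
  "moebius A p =
     (let a = complex_of_real (A$1$1); b = complex_of_real (A$1$2);
          c = complex_of_real (A$2$1); d = complex_of_real (A$2$2)
      in case p of
           None \<Rightarrow> if c = 0 then None else Some (a / c)
         | Some z \<Rightarrow> if c * z + d = 0 then None else Some ((a * z + b) / (c * z + d)))"

definition psl_act :: "(real^2^2) set \<Rightarrow> complex option \<Rightarrow> complex option" where
  "psl_act \<gamma> p = the_elem ((\<lambda>A. moebius A p) ` \<gamma>)"

lemma moebius_minus: "moebius (- A) p = moebius A p"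
proof (cases p)
  case None
  then show ?thesis by (simp add: moebius_def Let_def)
next
  case (Some z)
  have "(- a * z + - b) / (- c * z + - d) = (a * z + b) / (c * z + d)"
    and "- c * z + - d = 0 \<longleftrightarrow> c * z + d = 0" for a b c d :: complex
  proof -
    have *: "- c * z + - d = - (c * z + d)" "- a * z + - b = - (a * z + b)" by simp_all
    show "(- a * z + - b) / (- c * z + - d) = (a * z + b) / (c * z + d)"
      unfolding * by (rule minus_divide_divide)
    show "- c * z + - d = 0 \<longleftrightarrow> c * z + d = 0"
      unfolding * by (rule neg_equal_0_iff_equal)
  qed
  then show ?thesis
    unfolding moebius_def Let_def Some by (simp only: option.case uminus_vec_def vec_lambda_beta of_real_minus)
qed

lemma psl_act_coset: "psl_act {A, - A} p = moebius A p"
  by (simp add: psl_act_def moebius_minus)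

abbreviation subgrp :: "(real^2^2) set set \<Rightarrow> (real^2^2) set monoid" where
  "subgrp \<Gamma> \<equiv> PSL2R\<lparr>carrier := \<Gamma>\<rparr>"

abbreviation Stab :: "(real^2^2) set set \<Rightarrow> complex option \<Rightarrow> (real^2^2) set set" where
  "Stab \<Gamma> p \<equiv> stabilizer (subgrp \<Gamma>) psl_act p"

abbreviation Orb :: "(real^2^2) set set \<Rightarrow> complex option \<Rightarrow> complex option set" where
  "Orb \<Gamma> p \<equiv> orbit (subgrp \<Gamma>) psl_act p"

definition elliptic_points :: "(real^2^2) set set \<Rightarrow> complex option set" where
  "elliptic_points \<Gamma> = {p \<in> Some ` uhp. \<exists>\<gamma>\<in>\<Gamma>. elliptic_elt \<gamma> \<and> psl_act \<gamma> p = p}"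

definition cusps :: "(real^2^2) set set \<Rightarrow> complex option set" where
  "cusps \<Gamma> = {p \<in> boundary. \<exists>\<gamma>\<in>\<Gamma>. parabolic_elt \<gamma> \<and> psl_act \<gamma> p = p}"

definition vertex_order :: "(real^2^2) set set \<Rightarrow> complex option \<Rightarrow> enat" where
  "vertex_order \<Gamma> p = (if p \<in> cusps \<Gamma> then \<infinity> else enat (card (Stab \<Gamma> p)))"

section \<open>The quotient Riemann surface\<close>

definition uhp_star :: "(real^2^2) set set \<Rightarrow> complex option set" where
  "uhp_star \<Gamma> = Some ` uhp \<union> cusps \<Gamma>"

text \<open>The matrix \<open>\<sigma>\<close> sends the cusp to infinity, so that this is a horodisc tangent to
  the boundary at the cusp.\<close>

definition horodisc :: "real^2^2 \<Rightarrow> real \<Rightarrow> complex option set" where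
  "horodisc \<sigma> C = Some ` {\<tau> \<in> uhp. Im (the (moebius \<sigma> (Some \<tau>))) > C}"

definition uhp_star_topology :: "(real^2^2) set set \<Rightarrow> complex option topology" where
  "uhp_star_topology \<Gamma> = topology_generated_by
     ({Some ` U |U. open U \<and> U \<subseteq> uhp} \<union>
      {insert s (horodisc \<sigma> C) |s \<sigma> C.
         s \<in> cusps \<Gamma> \<and> \<sigma> \<in> carrier SL2R \<and> moebius \<sigma> s = None \<and> C > 0})"

definition quotient_space :: "(real^2^2) set set \<Rightarrow> complex option set topology" where
  "quotient_space \<Gamma> = quotient_topology (uhp_star_topology \<Gamma>) (Orb \<Gamma>)"

text \<open>A Riemann surface is a topology together with an atlas; a chart is a pair of an open
  set and a map defined on it (its values elsewhere are irrelevant).\<close>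

type_synonym 'a surface = "'a topology \<times> ('a set \<times> ('a \<Rightarrow> complex)) set"

definition precisely_invariant ::
    "(real^2^2) set set \<Rightarrow> complex option \<Rightarrow> complex option set \<Rightarrow> bool" where
  "precisely_invariant \<Gamma> p U \<longleftrightarrow>
     (\<forall>\<gamma>\<in>Stab \<Gamma> p. psl_act \<gamma> ` U = U) \<and>
     (\<forall>\<gamma>\<in>\<Gamma> - Stab \<Gamma> p. psl_act \<gamma> ` U \<inter> U = {})"

text \<open>A Cayley transform centred at \<open>\<tau>\<^sub>0\<close> turns the stabilizer, of order \<open>m\<close>, into
  the rotations by \<open>m\<close>-th roots of unity, whence the exponent. Points that are
  not elliptic have \<open>m = 1\<close>.\<close>

definition interior_charts ::
    "(real^2^2) set set \<Rightarrow> (complex option set set \<times> (complex option set \<Rightarrow> complex)) set" where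
  "interior_charts \<Gamma> = {(Orb \<Gamma> ` Some ` U, \<phi>) |U \<phi>. \<exists>\<tau>\<^sub>0\<in>U.
     open U \<and> U \<subseteq> uhp \<and> precisely_invariant \<Gamma> (Some \<tau>\<^sub>0) (Some ` U) \<and>
     (\<forall>\<tau>\<in>U. \<phi> (Orb \<Gamma> (Some \<tau>)) =
        ((\<tau> - \<tau>\<^sub>0) / (\<tau> - cnj \<tau>\<^sub>0)) ^ card (Stab \<Gamma> (Some \<tau>\<^sub>0)))}"

text \<open>Conjugation by \<open>\<sigma>\<close> turns the stabilizer of the cusp into the group of translations
  by integer multiples of the width \<open>b\<close>.\<close>

definition cusp_charts ::
    "(real^2^2) set set \<Rightarrow> (complex option set set \<times> (complex option set \<Rightarrow> complex)) set" where
  "cusp_charts \<Gamma> = {(Orb \<Gamma> ` insert s (horodisc \<sigma> C), \<phi>) |s \<sigma> C \<phi>. \<exists>b>0.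
     s \<in> cusps \<Gamma> \<and> \<sigma> \<in> carrier SL2R \<and> moebius \<sigma> s = None \<and> C > 0 \<and>
     precisely_invariant \<Gamma> s (insert s (horodisc \<sigma> C)) \<and>
     {x::real. \<exists>\<gamma>\<in>Stab \<Gamma> s. \<forall>\<tau>\<in>uhp.
        the (moebius \<sigma> (psl_act \<gamma> (Some \<tau>))) = the (moebius \<sigma> (Some \<tau>)) + of_real x}
       = range (\<lambda>m::int. of_int m * b) \<and>
     \<phi> (Orb \<Gamma> s) = 0 \<and>
     (\<forall>\<tau>. Some \<tau> \<in> horodisc \<sigma> C \<longrightarrow>
        \<phi> (Orb \<Gamma> (Some \<tau>)) = exp (2 * pi * \<i> * the (moebius \<sigma> (Some \<tau>)) / of_real b))}"

definition quotient_surface :: "(real^2^2) set set \<Rightarrow> complex option set surface" where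
  "quotient_surface \<Gamma> = (quotient_space \<Gamma>, interior_charts \<Gamma> \<union> cusp_charts \<Gamma>)"

definition riemann_sphere :: "complex option surface" where
  "riemann_sphere = (Alexandroff_compactification euclidean,
     {(range Some, the),
      (- {Some 0}, \<lambda>p. case p of None \<Rightarrow> 0 | Some z \<Rightarrow> 1 / z)})"

definition surface_holomorphic :: "'a surface \<Rightarrow> 'b surface \<Rightarrow> ('a \<Rightarrow> 'b) \<Rightarrow> bool" where
  "surface_holomorphic X Y f \<longleftrightarrow>
     continuous_map (fst X) (fst Y) f \<and>
     (\<forall>(U, \<phi>)\<in>snd X. \<forall>(V, \<psi>)\<in>snd Y.
        (\<lambda>z. \<psi> (f (inv_into U \<phi> z))) holomorphic_on \<phi> ` {p \<in> U. f p \<in> V})"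

definition surface_iso :: "'a surface \<Rightarrow> 'b surface \<Rightarrow> ('a \<Rightarrow> 'b) \<Rightarrow> bool" where
  "surface_iso X Y f \<longleftrightarrow>
     bij_betw f (topspace (fst X)) (topspace (fst Y)) \<and>
     surface_holomorphic X Y f \<and>
     surface_holomorphic Y X (inv_into (topspace (fst X)) f)"

text \<open>The genus of a compact connected orientable surface is half the rank of its
  first integral homology group.\<close>

definition has_genus :: "'a topology \<Rightarrow> nat \<Rightarrow> bool" where
  "has_genus X g \<longleftrightarrow> homology_group 1 X \<cong> free_Abelian_group {..<2 * g}"

section \<open>Signatures and Hauptmoduln\<close>

definition vertex_system ::
    "(real^2^2) set set \<Rightarrow> nat \<Rightarrow> (nat \<Rightarrow> complex option) \<Rightarrow> (nat \<Rightarrow> enat) \<Rightarrow> bool" where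
  "vertex_system \<Gamma> r t n \<longleftrightarrow>
     (\<forall>i\<in>{1..r}. t i \<in> elliptic_points \<Gamma> \<union> cusps \<Gamma> \<and> n i = vertex_order \<Gamma> (t i)) \<and>
     (\<forall>p\<in>elliptic_points \<Gamma> \<union> cusps \<Gamma>. \<exists>!i. i \<in> {1..r} \<and> t i \<in> Orb \<Gamma> p)"

definition has_signature ::
    "(real^2^2) set set \<Rightarrow> nat \<Rightarrow> nat \<Rightarrow> (nat \<Rightarrow> enat) \<Rightarrow> bool" where
  "has_signature \<Gamma> g r n \<longleftrightarrow>
     has_genus (quotient_space \<Gamma>) g \<and> (\<exists>t. vertex_system \<Gamma> r t n)"

definition recip_order :: "enat \<Rightarrow> real" where
  "recip_order m = (case m of enat q \<Rightarrow> 1 / real q | \<infinity> \<Rightarrow> 0)"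

text \<open>The complex-valued function underlying a sphere-valued one, with value 0 at poles as
  is the library's convention for \<open>nicely_meromorphic_on\<close>.\<close>

definition finite_part :: "(complex option \<Rightarrow> complex option) \<Rightarrow> complex \<Rightarrow> complex" where
  "finite_part w \<tau> = (case w (Some \<tau>) of None \<Rightarrow> 0 | Some z \<Rightarrow> z)"

text \<open>The argument \<open>w\<close> is the Hauptmodul together with its extension to the cusps, as a
  sphere-valued function; only its values on \<open>uhp_star \<Gamma>\<close> matter.\<close>

definition hauptmodul :: "(real^2^2) set set \<Rightarrow> (complex option \<Rightarrow> complex option) \<Rightarrow> bool" where
  "hauptmodul \<Gamma> w \<longleftrightarrow>
     finite_part w nicely_meromorphic_on uhp \<and>
     (\<forall>\<tau>\<in>uhp. w (Some \<tau>) = None \<longleftrightarrow> is_pole (finite_part w) \<tau>) \<and>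
     (\<forall>\<gamma>\<in>\<Gamma>. \<forall>p\<in>uhp_star \<Gamma>. w (psl_act \<gamma> p) = w p) \<and>
     (\<exists>W. (\<forall>p\<in>uhp_star \<Gamma>. W (Orb \<Gamma> p) = w p) \<and>
          surface_iso (quotient_surface \<Gamma>) riemann_sphere W)"

end

theory Submission
  imports Defs
begin

text \<open>
  Holomorphy at a point \<open>\<tau>\<close> of the upper half plane is a matter of counting orders of
  vanishing. Write \<open>F\<close> for the Hauptmodul \<open>w\<close> read as a meromorphic function and let \<open>m\<close> be its
  ramification index at \<open>\<tau>\<close>: the order of \<open>F - F \<tau>\<close>, or the order of the pole. Put \<open>K = k / 2\<close>.

  If \<open>F\<close> is finite at \<open>\<tau>\<close>, then \<open>(F')^K\<close> has order \<open>K (m - 1)\<close>, the power \<open>F^j\<close> has order at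
  least 0, and the denominator has order \<open>m\<close> times the sum of those \<open>a\<^sub>i\<close> with \<open>w\<^sub>i = w(\<tau>)\<close>. At
  a pole \<open>F'\<close> has order \<open>- m - 1\<close>, while \<open>F\<close> and all differences \<open>F - w\<^sub>i\<close> have order \<open>- m\<close>, and
  the bound \<open>j \<le> d - 1 = - 2 K + (\<Sum> a\<^sub>i)\<close> leaves an order of at least \<open>K (m - 1)\<close>
  minus \<open>m\<close> times the sum of those \<open>a\<^sub>i\<close> with \<open>w\<^sub>i = \<infinity>\<close>. So in both cases it is enough that
  \<open>m\<close> times the sum of the \<open>a\<^sub>i\<close> over the vertices with \<open>w\<^sub>i = w(\<tau>)\<close> is at most \<open>K (m - 1)\<close>
  (lemma \<open>vertex_weights_over_point\<close>).

  A Hauptmodul separates orbits, and the vertices are pairwise inequivalent; hence at most one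
  vertex \<open>t\<^sub>i\<close> takes the value \<open>w(\<tau>)\<close>, and it is equivalent to \<open>\<tau>\<close>, so it is an elliptic
  point. With \<open>e\<close> its order, \<open>a\<^sub>i \<le> K (1 - 1 / e)\<close>, and the required inequality follows
  from \<open>e \<le> m\<close>. This inequality between the order of the stabilizer and the ramification index
  (\<open>card_stabilizer_le_zorder\<close>) is a computation at the fixed point: an element of the stabilizer
  multiplies a local coordinate at its fixed point by a multiplier \<open>\<lambda>\<close> to first order, so it
  multiplies the leading term of an invariant function of order \<open>m\<close> by \<open>\<lambda>^m\<close>. Thus \<open>\<lambda>^m = 1\<close>,
  and a transformation is determined by its fixed point and its multiplier.

  All this presupposes that \<open>F\<close> is not constant. Cusps fall into finitely many orbits; were
  \<open>F\<close> constant, \<open>w\<close> would take only finitely many values, but it is onto the sphere.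
\<close>

section \<open>Moebius transformations of the upper half plane\<close>

definition moebius_map :: "real^2^2 \<Rightarrow> complex \<Rightarrow> complex" where
  "moebius_map A \<tau> = (of_real (A$1$1) * \<tau> + of_real (A$1$2)) / (of_real (A$2$1) * \<tau> + of_real (A$2$2))"

definition automorphy_factor :: "real^2^2 \<Rightarrow> complex \<Rightarrow> complex" where
  "automorphy_factor A \<tau> = of_real (A$2$1) * \<tau> + of_real (A$2$2)"

lemma automorphy_factor_nonzero:
  assumes "det A = 1" "\<tau> \<in> uhp"
  shows "automorphy_factor A \<tau> \<noteq> 0"
proof
  assume "automorphy_factor A \<tau> = 0"
  hence "Im (automorphy_factor A \<tau>) = 0" "Re (automorphy_factor A \<tau>) = 0" by simp_all
  hence "A$2$1 = 0" "A$2$2 = 0"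
    using assms(2) by (auto simp: automorphy_factor_def uhp_def)
  with assms(1) show False by (simp add: det_2)
qed

lemma moebius_Some:
  assumes "det A = 1" "\<tau> \<in> uhp"
  shows "moebius A (Some \<tau>) = Some (moebius_map A \<tau>)"
  using automorphy_factor_nonzero[OF assms]
  by (simp add: moebius_def moebius_map_def automorphy_factor_def Let_def)

lemma moebius_map_in_uhp:
  assumes "det A = 1" "\<tau> \<in> uhp"
  shows "moebius_map A \<tau> \<in> uhp"
proof -
  define N where "N = of_real (A$1$1) * \<tau> + of_real (A$1$2)"
  define D where "D = automorphy_factor A \<tau>"
  have "D \<noteq> 0" using automorphy_factor_nonzero[OF assms] by (simp add: D_def)
  have "Im N * Re D - Re N * Im D = det A * Im \<tau>"
    by (simp add: N_def D_def automorphy_factor_def det_2 algebra_simps)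
  moreover have "Im (moebius_map A \<tau>) = (Im N * Re D - Re N * Im D) / ((Re D)\<^sup>2 + (Im D)\<^sup>2)"
    by (simp add: moebius_map_def N_def D_def automorphy_factor_def Im_divide)
  moreover have "(Re D)\<^sup>2 + (Im D)\<^sup>2 > 0"
    using \<open>D \<noteq> 0\<close> by (auto simp: complex_neq_0)
  ultimately show ?thesis
    using assms by (simp add: uhp_def)
qed

lemma moebius_map_has_field_derivative:
  assumes "det A = 1" "\<tau> \<in> uhp"
  shows "(moebius_map A has_field_derivative 1 / automorphy_factor A \<tau> ^ 2) (at \<tau>)"
proof -
  have "of_real (A$1$1) * automorphy_factor A \<tau> - (of_real (A$1$1) * \<tau> + of_real (A$1$2)) * of_real (A$2$1)
        = complex_of_real (det A)"
    by (simp add: automorphy_factor_def det_2 algebra_simps)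
  with assms(1) have *: "of_real (A$1$1) * automorphy_factor A \<tau>
      - (of_real (A$1$1) * \<tau> + of_real (A$1$2)) * of_real (A$2$1) = 1" by simp
  have "((\<lambda>x. (of_real (A$1$1) * x + of_real (A$1$2)) / automorphy_factor A x) has_field_derivative
      (of_real (A$1$1) * automorphy_factor A \<tau> - (of_real (A$1$1) * \<tau> + of_real (A$1$2)) * of_real (A$2$1))
        / (automorphy_factor A \<tau> * automorphy_factor A \<tau>)) (at \<tau>)"
    using automorphy_factor_nonzero[OF assms] unfolding automorphy_factor_def
    by (auto intro!: derivative_eq_intros)
  thus ?thesis
    unfolding * by (simp add: moebius_map_def[abs_def] automorphy_factor_def power2_eq_square)
qed

lemma open_uhp: "open uhp"
  unfolding uhp_def by (simp add: open_halfspace_Im_gt)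

lemma connected_uhp: "connected uhp"
  unfolding uhp_def by (intro convex_connected convex_halfspace_Im_gt)

lemma eventually_uhp: "\<tau> \<in> uhp \<Longrightarrow> eventually (\<lambda>x. x \<in> uhp) (at \<tau>)"
  using open_uhp by (rule eventually_at_in_open')

section \<open>Orders of functions invariant under a local biholomorphism\<close>

text \<open>Near \<open>z\<close> the function \<open>G\<close> is \<open>P x * (x - z) powi n\<close> with \<open>P z \<noteq> 0\<close>. Comparing this
  expression at \<open>\<mu> x\<close> and at \<open>x\<close> gives \<open>((\<mu> x - z) / (x - z)) powi n = P x / P (\<mu> x)\<close>, whose
  right-hand side tends to 1.\<close>

lemma multiplier_powi_zorder:
  fixes G \<mu> :: "complex \<Rightarrow> complex"
  assumes G: "G meromorphic_on {z}" "eventually (\<lambda>x. G x \<noteq> 0) (at z)"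
    and \<mu>: "(\<mu> has_field_derivative lam) (at z)" "\<mu> z = z" "lam \<noteq> 0"
    and inv: "eventually (\<lambda>x. G (\<mu> x) = G x) (at z)"
  shows "lam powi zorder G z = 1"
proof -
  define n where "n = zorder G z"
  define P where "P = zor_poly G z"
  have fr: "frequently (\<lambda>x. G x \<noteq> 0) (at z)"
    using G(2) by (simp add: eventually_frequently)
  obtain r where r: "r > 0" "P holomorphic_on cball z r" "P z \<noteq> 0"
    and eq: "\<And>x. x \<in> cball z r - {z} \<Longrightarrow> G x = P x * (x - z) powi n \<and> P x \<noteq> 0"
    using zorder_exist[OF _ _ fr] G(1) unfolding n_def P_def
    by (metis meromorphic_on_isolated_singularity meromorphic_on_not_essential)
  have lim\<mu>: "(\<mu> \<longlongrightarrow> z) (at z)"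
    using DERIV_isCont[OF \<mu>(1)] \<mu>(2) by (simp add: isCont_def)
  have limP: "(P \<longlongrightarrow> P z) (at z)"
    using r by (metis ball_subset_cball centre_in_ball holomorphic_on_imp_continuous_on
        continuous_on_interior interior_cball isCont_def)
  have quot: "((\<lambda>x. (\<mu> x - z) / (x - z)) \<longlongrightarrow> lam) (at z)"
    using \<mu>(1,2) by (simp add: has_field_derivative_iff)
  have quot_nz: "eventually (\<lambda>x. (\<mu> x - z) / (x - z) \<noteq> 0) (at z)"
    using quot \<mu>(3) by (rule tendsto_imp_eventually_ne)
  hence ne: "eventually (\<lambda>x. \<mu> x \<noteq> z) (at z)"
    by eventually_elim auto
  have "filterlim \<mu> (at z) (at z)"
    using lim\<mu> ne by (simp add: filterlim_at)
  hence "((\<lambda>x. P (\<mu> x)) \<longlongrightarrow> P z) (at z)"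
    by (rule filterlim_compose[OF limP])
  hence lim2: "((\<lambda>x. P x / P (\<mu> x)) \<longlongrightarrow> P z / P z) (at z)"
    using r(3) by (intro tendsto_divide limP)
  have near: "eventually (\<lambda>x. x \<in> ball z r) (at z)"
    using r(1) by (intro eventually_at_in_open') auto
  have near': "eventually (\<lambda>x. \<mu> x \<in> ball z r) (at z)"
    using lim\<mu> r(1) by (auto simp: tendsto_iff dist_commute)
  have "eventually (\<lambda>x. ((\<mu> x - z) / (x - z)) powi n = P x / P (\<mu> x)) (at z)"
    using near near' ne inv eventually_neq_at_within[of z z UNIV]
  proof eventually_elim
    case (elim x)
    have "P (\<mu> x) * (\<mu> x - z) powi n = P x * (x - z) powi n" "P (\<mu> x) \<noteq> 0" "(x - z) powi n \<noteq> 0"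
      using eq[of x] eq[of "\<mu> x"] elim by auto
    thus ?case
      by (simp add: power_int_divide_distrib field_simps)
  qed
  moreover have "((\<lambda>x. ((\<mu> x - z) / (x - z)) powi n) \<longlongrightarrow> lam powi n) (at z)"
    using quot \<mu>(3) by (intro tendsto_power_int) auto
  ultimately have "((\<lambda>x. P x / P (\<mu> x)) \<longlongrightarrow> lam powi n) (at z)"
    by (rule Lim_transform_eventually[rotated])
  with lim2 have "lam powi n = P z / P z"
    by (intro tendsto_unique[of "at z"]) auto
  thus ?thesis
    using r(3) by (simp add: n_def)
qed

text \<open>A local biholomorphism has order 1 at every point, and orders multiply under
  composition.\<close>

lemma zorder_biholomorphic_invariant:
  fixes G \<mu> :: "complex \<Rightarrow> complex"
  assumes G: "G meromorphic_on {\<mu> z}" "eventually (\<lambda>x. G x \<noteq> 0) (at (\<mu> z))"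
    and \<mu>: "\<mu> analytic_on {z}" "deriv \<mu> z \<noteq> 0"
    and inv: "eventually (\<lambda>x. G (\<mu> x) = G x) (at z)"
  shows "zorder G z = zorder G (\<mu> z)"
proof -
  have D: "(\<mu> has_field_derivative deriv \<mu> z) (at z)"
    using \<mu>(1) by (simp add: analytic_on_imp_differentiable_at DERIV_deriv_iff_field_differentiable)
  have "((\<lambda>x. (\<mu> x - \<mu> z) / (x - z)) \<longlongrightarrow> deriv \<mu> z) (at z)"
    using D by (simp add: has_field_derivative_iff)
  hence "eventually (\<lambda>x. (\<mu> x - \<mu> z) / (x - z) \<noteq> 0) (at z)"
    using \<mu>(2) by (rule tendsto_imp_eventually_ne)
  hence ne: "eventually (\<lambda>x. \<mu> x \<noteq> \<mu> z) (at z)"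
    by eventually_elim auto
  have "zorder (\<lambda>x. \<mu> x - \<mu> z) z = 1"
  proof (rule zorder_zero_eqI')
    show "(\<lambda>x. \<mu> x - \<mu> z) analytic_on {z}" using \<mu>(1) by (intro analytic_intros)
    have "deriv (\<lambda>x. \<mu> x - \<mu> z) z = deriv \<mu> z"
      by (rule DERIV_imp_deriv) (auto intro!: derivative_eq_intros D)
    thus "(deriv ^^ nat 1) (\<lambda>x. \<mu> x - \<mu> z) z \<noteq> 0" using \<mu>(2) by simp
  qed auto
  moreover have "zorder (G \<circ> \<mu>) z = zorder G (\<mu> z) * zorder (\<lambda>x. \<mu> x - \<mu> z) z"
    using G \<mu>(1) ne
    by (intro zorder_compose' meromorphic_on_isolated_singularity meromorphic_on_not_essential)
  moreover have "zorder (G \<circ> \<mu>) z = zorder G z"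
    using inv by (intro zorder_cong) auto
  ultimately show ?thesis by simp
qed

section \<open>Stabilizers and orbits\<close>

definition psl_invariant :: "(real^2^2) set set \<Rightarrow> (complex \<Rightarrow> complex) \<Rightarrow> bool" where
  "psl_invariant \<Gamma> G \<longleftrightarrow> (\<forall>\<gamma>\<in>\<Gamma>. \<forall>A\<in>\<gamma>. \<forall>\<tau>\<in>uhp. G (moebius_map A \<tau>) = G \<tau>)"

lemma det_in_PSL2R: "\<gamma> \<in> carrier PSL2R \<Longrightarrow> A \<in> \<gamma> \<Longrightarrow> det A = 1"
  by (auto simp: carrier_PSL2R det_2)

lemma psl_act_uhp:
  assumes "\<gamma> \<in> carrier PSL2R" "A \<in> \<gamma>" "\<tau> \<in> uhp"
  shows "psl_act \<gamma> (Some \<tau>) = Some (moebius_map A \<tau>)"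
proof -
  have "psl_act \<gamma> (Some \<tau>) = moebius A (Some \<tau>)"
    using assms(1,2) by (auto simp: carrier_PSL2R psl_act_coset moebius_minus)
  thus ?thesis
    using moebius_Some[OF det_in_PSL2R[OF assms(1,2)] assms(3)] by simp
qed

lemma one_PSL2R: "\<one>\<^bsub>PSL2R\<^esub> = {mat 1, - mat 1}"
  by (simp add: PSL2R_def FactGroup_def)

lemma psl_act_one: "psl_act \<one>\<^bsub>PSL2R\<^esub> p = p"
  unfolding one_PSL2R psl_act_coset by (cases p) (auto simp: moebius_def mat_def)

text \<open>A transformation \<open>A\<close> fixing \<open>\<tau>\<close> has multiplier \<open>1 / (automorphy_factor A \<tau>)^2\<close> there. By
  \<open>multiplier_powi_zorder\<close> all these multipliers are roots of unity of degree
  \<open>\<bar>zorder G \<tau>\<bar>\<close>; since the map from the stabilizer to them is injective, the stabilizer is finite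
  and no larger than the degree. The lower bound excludes the value 0 that \<^const>\<open>card\<close> would give to
  an infinite set.\<close>

lemma card_stabilizer_le_zorder:
  assumes \<Gamma>: "subgroup \<Gamma> PSL2R" and \<tau>: "\<tau> \<in> uhp"
    and G: "G meromorphic_on {\<tau>}" "eventually (\<lambda>x. G x \<noteq> 0) (at \<tau>)" "psl_invariant \<Gamma> G"
    and ord: "zorder G \<tau> \<noteq> 0"
  shows "1 \<le> card (Stab \<Gamma> (Some \<tau>))" "int (card (Stab \<Gamma> (Some \<tau>))) \<le> \<bar>zorder G \<tau>\<bar>"
proof -
  define m where "m = nat \<bar>zorder G \<tau>\<bar>"
  have m: "1 \<le> m" using ord by (simp add: m_def)
  define rep where "rep \<gamma> = (SOME A. A \<in> \<gamma>)" for \<gamma> :: "(real^2^2) set"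
  define J where "J \<gamma> = automorphy_factor (rep \<gamma>) \<tau> ^ 2" for \<gamma>
  have \<Gamma>': "\<gamma> \<in> carrier PSL2R" if "\<gamma> \<in> \<Gamma>" for \<gamma>
    using subgroup.subset[OF \<Gamma>] that by blast
  have S: "\<gamma> \<in> \<Gamma>" "psl_act \<gamma> (Some \<tau>) = Some \<tau>" if "\<gamma> \<in> Stab \<Gamma> (Some \<tau>)" for \<gamma>
    using that by (auto simp: stabilizer_def)
  have rep: "rep \<gamma> \<in> \<gamma>" "\<gamma> = {rep \<gamma>, - rep \<gamma>}" "det (rep \<gamma>) = 1" if "\<gamma> \<in> carrier PSL2R" for \<gamma>
  proof -
    from that obtain A where A: "\<gamma> = {A, - A}" "det A = 1" by (auto simp: carrier_PSL2R)
    show *: "rep \<gamma> \<in> \<gamma>" unfolding rep_def by (rule someI[of _ A]) (simp add: A)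
    thus "\<gamma> = {rep \<gamma>, - rep \<gamma>}" using A by auto
    show "det (rep \<gamma>) = 1" using det_in_PSL2R[OF that *] .
  qed
  have fixed: "moebius_map (rep \<gamma>) \<tau> = \<tau>" if "\<gamma> \<in> Stab \<Gamma> (Some \<tau>)" for \<gamma>
    using psl_act_uhp[OF \<Gamma>'[OF S(1)[OF that]] rep(1)[OF \<Gamma>'[OF S(1)[OF that]]] \<tau>] S(2)[OF that] by simp
  have root: "J \<gamma> ^ m = 1" if st: "\<gamma> \<in> Stab \<Gamma> (Some \<tau>)" for \<gamma>
  proof -
    note c = \<Gamma>'[OF S(1)[OF st]]
    have nz: "J \<gamma> \<noteq> 0" using automorphy_factor_nonzero[OF rep(3)[OF c] \<tau>] by (simp add: J_def)
    have "(1 / J \<gamma>) powi zorder G \<tau> = 1"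
    proof (rule multiplier_powi_zorder[OF G(1,2)])
      show "(moebius_map (rep \<gamma>) has_field_derivative 1 / J \<gamma>) (at \<tau>)"
        unfolding J_def by (rule moebius_map_has_field_derivative[OF rep(3)[OF c] \<tau>])
      show "\<forall>\<^sub>F x in at \<tau>. G (moebius_map (rep \<gamma>) x) = G x"
        using eventually_uhp[OF \<tau>] 
        by eventually_elim (use G(3) S(1)[OF st] rep(1)[OF c] in \<open>auto simp: psl_invariant_def\<close>)
    qed (use fixed[OF st] nz in auto)
    hence "J \<gamma> powi zorder G \<tau> = 1" "J \<gamma> powi (- zorder G \<tau>) = 1"
      by (simp_all add: power_int_divide_distrib power_int_minus)
    hence "J \<gamma> powi int m = 1" unfolding m_def by (cases "zorder G \<tau> \<ge> 0") auto
    thus ?thesis by simp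
  qed
  have inj: "inj_on J (Stab \<Gamma> (Some \<tau>))"
  proof (rule inj_onI)
    fix \<gamma> \<delta> assume \<gamma>: "\<gamma> \<in> Stab \<Gamma> (Some \<tau>)" and \<delta>: "\<delta> \<in> Stab \<Gamma> (Some \<tau>)" and "J \<gamma> = J \<delta>"
    note c = \<Gamma>'[OF S(1)[OF \<gamma>]] and d = \<Gamma>'[OF S(1)[OF \<delta>]]
    \<comment> \<open>As \<open>\<tau>\<close> is not real, the automorphy factor at \<open>\<tau>\<close> determines the bottom row of the
      matrix; the fixed point equation then does the same for the top row.\<close>
    have ext: "A = B" if AB: "det A = 1" "det B = 1" "moebius_map A \<tau> = \<tau>" "moebius_map B \<tau> = \<tau>"
      "automorphy_factor A \<tau> = automorphy_factor B \<tau>" for A B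
    proof -
      have real_eq: "p = p' \<and> q = q'"
        if "complex_of_real p * \<tau> + of_real q = of_real p' * \<tau> + of_real q'" for p q p' q'
      proof -
        from that have "p * Im \<tau> = p' * Im \<tau>" by (simp add: complex_eq_iff)
        hence "p = p'" using \<tau> by (simp add: uhp_def)
        with that show ?thesis by simp
      qed
      have num: "of_real (X$1$1) * \<tau> + of_real (X$1$2) = \<tau> * automorphy_factor X \<tau>"
        if "det X = 1" "moebius_map X \<tau> = \<tau>" for X
        using that automorphy_factor_nonzero[OF that(1) \<tau>] by (simp add: moebius_map_def automorphy_factor_def field_simps)
      have "A$1$1 = B$1$1 \<and> A$1$2 = B$1$2"
        by (rule real_eq) (use num[OF AB(1,3)] num[OF AB(2,4)] AB(5) in simp)
      moreover have "A$2$1 = B$2$1 \<and> A$2$2 = B$2$2"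
        by (rule real_eq) (use AB(5) in \<open>simp add: automorphy_factor_def\<close>)
      ultimately show ?thesis by (simp add: vec_eq_iff forall_2)
    qed
    from \<open>J \<gamma> = J \<delta>\<close> have "automorphy_factor (rep \<gamma>) \<tau> = automorphy_factor (rep \<delta>) \<tau>
        \<or> automorphy_factor (rep \<gamma>) \<tau> = automorphy_factor (- rep \<delta>) \<tau>"
      by (auto simp: J_def power2_eq_iff automorphy_factor_def)
    moreover have "- rep \<delta> \<in> \<delta>" using rep(2)[OF d] by blast
    hence "moebius_map (- rep \<delta>) \<tau> = \<tau>" "det (- rep \<delta>) = 1"
      using psl_act_uhp[OF d _ \<tau>, of "- rep \<delta>"] det_in_PSL2R[OF d, of "- rep \<delta>"] 
        S(2)[OF \<delta>] by simp_all
    ultimately have "rep \<gamma> = rep \<delta> \<or> rep \<gamma> = - rep \<delta>"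
      using ext rep(3)[OF c] rep(3)[OF d] fixed[OF \<gamma>] fixed[OF \<delta>] by blast
    thus "\<gamma> = \<delta>" using rep(2)[OF c] rep(2)[OF d] by auto
  qed
  have sub: "J ` Stab \<Gamma> (Some \<tau>) \<subseteq> {z. z ^ m = 1}" using root by auto
  have fin: "finite (Stab \<Gamma> (Some \<tau>))"
    using inj finite_subset[OF sub finite_roots_unity[OF m]] by (rule finite_imageD[rotated])
  have "\<one>\<^bsub>PSL2R\<^esub> \<in> Stab \<Gamma> (Some \<tau>)"
    using subgroup.one_closed[OF \<Gamma>] by (simp add: stabilizer_def psl_act_one)
  with fin show "1 \<le> card (Stab \<Gamma> (Some \<tau>))"
    by (metis One_nat_def Suc_leI card_gt_0_iff empty_iff)
  have "card (Stab \<Gamma> (Some \<tau>)) \<le> m"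
    using card_inj_on_le[OF inj sub finite_roots_unity[OF m]] card_roots_unity[OF m, where 'a=complex] by simp
  thus "int (card (Stab \<Gamma> (Some \<tau>))) \<le> \<bar>zorder G \<tau>\<bar>"
    by (simp add: m_def)
qed

lemma zorder_orbit:
  assumes \<Gamma>: "subgroup \<Gamma> PSL2R" and \<tau>: "\<tau> \<in> uhp" and s: "p \<in> Orb \<Gamma> (Some \<tau>)"
    and G: "G meromorphic_on uhp" "\<And>x. x \<in> uhp \<Longrightarrow> eventually (\<lambda>y. G y \<noteq> 0) (at x)"
      "psl_invariant \<Gamma> G"
  obtains \<sigma> where "p = Some \<sigma>" "\<sigma> \<in> uhp" "zorder G \<sigma> = zorder G \<tau>"
proof -
  from s obtain \<gamma> where \<gamma>: "\<gamma> \<in> \<Gamma>" "p = psl_act \<gamma> (Some \<tau>)" by (auto simp: orbit_def)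
  have c: "\<gamma> \<in> carrier PSL2R" using subgroup.subset[OF \<Gamma>] \<gamma>(1) by blast
  then obtain A where A: "A \<in> \<gamma>" "det A = 1" by (auto simp: carrier_PSL2R)
  have p: "p = Some (moebius_map A \<tau>)" using psl_act_uhp[OF c A(1) \<tau>] \<gamma>(2) by simp
  have up: "moebius_map A \<tau> \<in> uhp" using moebius_map_in_uhp[OF A(2) \<tau>] .
  have "zorder G \<tau> = zorder G (moebius_map A \<tau>)"
  proof (rule zorder_biholomorphic_invariant)
    have "moebius_map A holomorphic_on uhp"
      using moebius_map_has_field_derivative[OF A(2)] open_uhp
      by (auto simp: holomorphic_on_open)
    thus "moebius_map A analytic_on {\<tau>}"
      using open_uhp \<tau> by (auto intro: holomorphic_on_imp_analytic_at)
    show "deriv (moebius_map A) \<tau> \<noteq> 0"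
      using DERIV_imp_deriv[OF moebius_map_has_field_derivative[OF A(2) \<tau>]] automorphy_factor_nonzero[OF A(2) \<tau>] by simp
    show "\<forall>\<^sub>F x in at \<tau>. G (moebius_map A x) = G x"
      using eventually_uhp[OF \<tau>]
      by eventually_elim (use G(3) \<gamma>(1) A(1) in \<open>auto simp: psl_invariant_def\<close>)
  qed (use G up in \<open>auto intro: meromorphic_on_subset\<close>)
  thus ?thesis using that p up by simp
qed

section \<open>The order of the candidate forms\<close>

text \<open>Unlike a constant, a function of nonzero order has a leading term that survives
  differentiation.\<close>

lemma deriv_eventually_nonzero:
  assumes "F meromorphic_on {z}" "eventually (\<lambda>x. F x \<noteq> 0) (at z)" "zorder F z \<noteq> 0"
  shows "eventually (\<lambda>x. deriv F x \<noteq> 0) (at z)"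
proof -
  obtain L where L: "(\<lambda>w. F (z + w)) has_laurent_expansion L"
    using assms(1) by (auto simp: meromorphic_on_def)
  have "L \<noteq> 0"
    using has_laurent_expansion_eventually_nonzero_iff[OF L] assms(2) by simp
  hence "fls_subdegree L \<noteq> 0"
    using has_laurent_expansion_zorder[OF L] assms(3) by simp
  hence nz: "fls_deriv L \<noteq> 0"
    by (metis \<open>L \<noteq> 0\<close> fls_deriv_nth fls_zero_nth mult_eq_0_iff nth_fls_subdegree_nonzero
        diff_add_cancel of_int_eq_0_iff)
  have "(\<lambda>w. deriv F (z + w)) = deriv (\<lambda>w. F (z + w))"
    by (simp add: deriv_shift_0' add_ac o_def fun_eq_iff)
  hence "(\<lambda>w. deriv F (z + w)) has_laurent_expansion fls_deriv L"
    using has_laurent_expansion_deriv[OF L] by simp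
  from has_laurent_expansion_eventually_nonzero_iff[OF this] nz show ?thesis by simp
qed

lemma zorder_candidate_form:
  fixes F :: "complex \<Rightarrow> complex" and a :: "nat \<Rightarrow> int"
  assumes F: "F meromorphic_on {z}" "eventually (\<lambda>x. F x \<noteq> 0) (at z)"
      "eventually (\<lambda>x. deriv F x \<noteq> 0) (at z)"
    and I: "finite I" "\<And>i. i \<in> I \<Longrightarrow> eventually (\<lambda>x. F x \<noteq> b i) (at z)"
  shows "zorder (\<lambda>x. deriv F x ^ K * F x ^ j / (\<Prod>i\<in>I. (F x - b i) powi a i)) z
    = int K * zorder (deriv F) z + int j * zorder F z - (\<Sum>i\<in>I. a i * zorder (\<lambda>x. F x - b i) z)"
proof -
  have fr: "frequently P (at z)" if "eventually P (at z)" for P :: "complex \<Rightarrow> bool"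
    using that by (simp add: eventually_frequently)
  have "eventually (\<lambda>x. \<forall>i\<in>I. F x \<noteq> b i) (at z)"
    using I by (intro eventually_ball_finite) auto
  hence den: "eventually (\<lambda>x. (\<Prod>i\<in>I. (F x - b i) powi a i) \<noteq> 0) (at z)"
    by eventually_elim (use I in \<open>auto simp: prod_zero_iff\<close>)
  have num: "eventually (\<lambda>x. deriv F x ^ K * F x ^ j \<noteq> 0) (at z)"
    using F(2,3) by eventually_elim auto
  have zp: "zorder (\<lambda>x. \<Prod>i\<in>I. (F x - b i) powi a i) z
      = (\<Sum>i\<in>I. zorder (\<lambda>x. (F x - b i) powi a i) z)"
    using den F(1) by (intro zorder_prod meromorphic_intros) auto
  have zi: "zorder (\<lambda>x. (F x - b i) powi a i) z = a i * zorder (\<lambda>x. F x - b i) z" if "i \<in> I" for i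
    using I(2)[OF that] F(1) by (intro zorder_power_int meromorphic_intros fr) auto
  have "zorder (\<lambda>x. deriv F x ^ K * F x ^ j / (\<Prod>i\<in>I. (F x - b i) powi a i)) z
    = zorder (\<lambda>x. deriv F x ^ K * F x ^ j) z - zorder (\<lambda>x. \<Prod>i\<in>I. (F x - b i) powi a i) z"
    using F(1) num den by (intro zorder_divide meromorphic_intros fr) auto
  also have "zorder (\<lambda>x. deriv F x ^ K * F x ^ j) z
      = zorder (\<lambda>x. deriv F x ^ K) z + zorder (\<lambda>x. F x ^ j) z"
    using F(1) by (intro zorder_mult meromorphic_intros fr eventually_mono[OF F(2)]
      eventually_mono[OF F(3)]) auto
  also have "zorder (\<lambda>x. deriv F x ^ K) z = int K * zorder (deriv F) z"
    using F by (intro zorder_power meromorphic_intros fr) auto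
  also have "zorder (\<lambda>x. F x ^ j) z = int j * zorder F z"
    using F by (intro zorder_power fr) auto
  finally show ?thesis using zp zi by simp
qed

section \<open>Hauptmoduln and vertices\<close>

text \<open>A cusp lies in the space only because some horodisc is attached to it; this needs a
  matrix that sends the cusp to infinity.\<close>

lemma topspace_uhp_star: "topspace (uhp_star_topology \<Gamma>) = uhp_star \<Gamma>"
proof
  show "topspace (uhp_star_topology \<Gamma>) \<subseteq> uhp_star \<Gamma>"
    by (auto simp: uhp_star_topology_def uhp_star_def horodisc_def)
  have uhp: "Some ` uhp \<subseteq> topspace (uhp_star_topology \<Gamma>)"
    using open_uhp by (auto simp: uhp_star_topology_def)
  have cusp: "s \<in> topspace (uhp_star_topology \<Gamma>)" if s: "s \<in> cusps \<Gamma>" for s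
  proof -
    have "\<exists>\<sigma>\<in>carrier SL2R. moebius \<sigma> s = None"
    proof (cases s)
      case None
      have "mat 1 \<in> carrier SL2R" "moebius (mat 1) s = None"
        using None by (simp_all add: SL2R_def moebius_def) (simp_all add: mat_def)
      thus ?thesis by blast
    next
      case (Some z)
      then obtain x where x: "s = Some (complex_of_real x)"
        using s by (auto simp: cusps_def boundary_def)
      define \<sigma> :: "real^2^2" where "\<sigma> = vector [vector [0, 1], vector [-1, x]]"
      have "\<sigma> \<in> carrier SL2R" "moebius \<sigma> s = None"
        using x by (auto simp: SL2R_def moebius_def \<sigma>_def det_2)
      thus ?thesis by blast
    qed
    then obtain \<sigma> where "\<sigma> \<in> carrier SL2R" "moebius \<sigma> s = None" by blast
    moreover have "(0::real) < 1" by simp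
    ultimately have "insert s (horodisc \<sigma> 1) \<in> {insert s (horodisc \<sigma> C) |s \<sigma> C.
         s \<in> cusps \<Gamma> \<and> \<sigma> \<in> carrier SL2R \<and> moebius \<sigma> s = None \<and> C > 0}"
      using s by blast
    thus ?thesis unfolding uhp_star_topology_def topology_generated_by_topspace by blast
  qed
  show "uhp_star \<Gamma> \<subseteq> topspace (uhp_star_topology \<Gamma>)"
    using uhp cusp by (auto simp: uhp_star_def)
qed

lemma elliptic_points_subset: "elliptic_points \<Gamma> \<subseteq> uhp_star \<Gamma>"
  by (auto simp: elliptic_points_def uhp_star_def)

lemma cusp_notin_uhp: "\<tau> \<in> uhp \<Longrightarrow> Some \<tau> \<notin> cusps \<Gamma>"
  by (auto simp: cusps_def boundary_def uhp_def)

lemma hauptmodul_separates: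
  assumes "hauptmodul \<Gamma> w" "p \<in> uhp_star \<Gamma>" "q \<in> uhp_star \<Gamma>" "w p = w q"
  shows "Orb \<Gamma> p = Orb \<Gamma> q"
proof -
  obtain W where W: "\<And>p. p \<in> uhp_star \<Gamma> \<Longrightarrow> W (Orb \<Gamma> p) = w p"
    and "surface_iso (quotient_surface \<Gamma>) riemann_sphere W"
    using assms(1) unfolding hauptmodul_def by blast
  hence "inj_on W (Orb \<Gamma> ` uhp_star \<Gamma>)"
    by (simp add: surface_iso_def bij_betw_def quotient_surface_def quotient_space_def topspace_uhp_star)
  moreover have "W (Orb \<Gamma> p) = W (Orb \<Gamma> q)" using assms(2-4) W by metis
  ultimately show ?thesis using assms(2,3) by (simp add: inj_on_eq_iff)
qed

lemma hauptmodul_surj: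
  assumes "hauptmodul \<Gamma> w"
  shows "w ` uhp_star \<Gamma> = UNIV"
proof -
  obtain W where W: "\<And>p. p \<in> uhp_star \<Gamma> \<Longrightarrow> W (Orb \<Gamma> p) = w p"
    and "surface_iso (quotient_surface \<Gamma>) riemann_sphere W"
    using assms(1) unfolding hauptmodul_def by blast
  hence "W ` Orb \<Gamma> ` uhp_star \<Gamma> = topspace (Alexandroff_compactification euclidean)"
    by (simp add: surface_iso_def bij_betw_def quotient_surface_def quotient_space_def
        topspace_uhp_star riemann_sphere_def)
  also have "\<dots> = UNIV" by (auto simp: UNIV_option_conv)
  also have "W ` Orb \<Gamma> ` uhp_star \<Gamma> = w ` uhp_star \<Gamma>"
    unfolding image_image using W by (rule image_cong[OF refl])
  finally show ?thesis .
qed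

lemma identity_mem_orbit: "subgroup \<Gamma> PSL2R \<Longrightarrow> p \<in> Orb \<Gamma> p"
  using psl_act_one[of p] subgroup.one_closed[of \<Gamma> PSL2R] by (force simp: orbit_def)

lemma vertex_values_distinct:
  assumes "subgroup \<Gamma> PSL2R" "vertex_system \<Gamma> r t n" "hauptmodul \<Gamma> w"
    and "i \<in> {1..r}" "i' \<in> {1..r}" "w (t i) = w (t i')"
  shows "i = i'"
proof -
  have v: "t i \<in> elliptic_points \<Gamma> \<union> cusps \<Gamma>" "t i' \<in> elliptic_points \<Gamma> \<union> cusps \<Gamma>"
    using assms by (auto simp: vertex_system_def)
  hence "Orb \<Gamma> (t i) = Orb \<Gamma> (t i')"
    using elliptic_points_subset[of \<Gamma>] assms(6) 
    by (intro hauptmodul_separates[OF assms(3)]) (auto simp: uhp_star_def)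
  hence "t i \<in> Orb \<Gamma> (t i')" "t i' \<in> Orb \<Gamma> (t i')"
    using identity_mem_orbit[OF assms(1)] by blast+
  moreover have "\<exists>!l. l \<in> {1..r} \<and> t l \<in> Orb \<Gamma> (t i')"
    using assms(2) v(2) unfolding vertex_system_def by blast
  ultimately show ?thesis using assms(4,5) by blast
qed

text \<open>The cusps contribute at most \<open>r\<close> values of \<open>w\<close>, one for each vertex, so if \<open>w\<close> were
  constant on the upper half plane then its range, the whole sphere, would be finite.\<close>

lemma hauptmodul_nonconstant:
  assumes v: "vertex_system \<Gamma> r t n" and w: "hauptmodul \<Gamma> w" and \<tau>: "\<tau> \<in> uhp"
  shows "eventually (\<lambda>x. finite_part w x \<noteq> c) (at \<tau>)"
proof -
  let ?f = "finite_part w"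
  have nice: "?f nicely_meromorphic_on uhp"
    and pole: "\<And>\<tau>. \<tau> \<in> uhp \<Longrightarrow> w (Some \<tau>) = None \<longleftrightarrow> is_pole ?f \<tau>"
    and inv: "\<And>\<gamma> p. \<gamma> \<in> \<Gamma> \<Longrightarrow> p \<in> uhp_star \<Gamma> \<Longrightarrow> w (psl_act \<gamma> p) = w p"
    using w by (auto simp: hauptmodul_def)
  have "\<not> (\<forall>x\<in>uhp. ?f x = c)"
  proof
    assume const: "\<forall>x\<in>uhp. ?f x = c"
    have "w (Some x) = Some c" if x: "x \<in> uhp" for x
    proof -
      have "eventually (\<lambda>y. ?f y = c) (at x)"
        using eventually_uhp[OF x] by eventually_elim (use const in auto)
      hence "\<not> is_pole ?f x"
        using is_pole_cong[of ?f "\<lambda>_. c" x x] by simp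
      with pole[OF x] const x show ?thesis by (auto simp: finite_part_def split: option.splits)
    qed
    moreover have "w p \<in> w ` t ` {1..r}" if p: "p \<in> cusps \<Gamma>" for p
    proof -
      obtain i where i: "i \<in> {1..r}" "t i \<in> Orb \<Gamma> p"
        using v p unfolding vertex_system_def by blast
      then obtain \<gamma> where "\<gamma> \<in> \<Gamma>" "t i = psl_act \<gamma> p" by (auto simp: orbit_def)
      with inv[of \<gamma> p] p i(1) show ?thesis by (auto simp: uhp_star_def intro!: image_eqI[of _ _ "t i"])
    qed
    ultimately have "w ` uhp_star \<Gamma> \<subseteq> insert (Some c) (w ` t ` {1..r})"
      by (auto simp: uhp_star_def)
    hence "finite (UNIV :: complex option set)"
      unfolding hauptmodul_surj[OF w] by (rule finite_subset) auto
    thus False by (simp add: infinite_UNIV_char_0)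
  qed
  hence "\<forall>\<^sub>\<approx>x\<in>uhp. ?f x \<noteq> c"
    using nicely_meromorphic_imp_constant_or_avoid[OF nice open_uhp connected_uhp] by blast
  thus ?thesis using \<tau> by (simp add: eventually_cosparse_open_eq open_uhp)
qed

lemma hauptmodul_invariant:
  assumes "subgroup \<Gamma> PSL2R" "hauptmodul \<Gamma> w"
  shows "psl_invariant \<Gamma> (finite_part w)"
  unfolding psl_invariant_def
proof safe
  fix \<gamma> A \<tau> assume *: "\<gamma> \<in> \<Gamma>" "A \<in> \<gamma>" "\<tau> \<in> uhp"
  have "\<gamma> \<in> carrier PSL2R" using subgroup.subset[OF assms(1)] *(1) by blast
  from psl_act_uhp[OF this *(2,3)] have "w (Some (moebius_map A \<tau>)) = w (Some \<tau>)"
    using assms(2) * by (metis (no_types, lifting) UnCI hauptmodul_def image_eqI uhp_star_def)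
  thus "finite_part w (moebius_map A \<tau>) = finite_part w \<tau>" by (simp add: finite_part_def)
qed

section \<open>Vertex weights against ramification\<close>

lemma floor_vertex_weight:
  fixes m :: int
  assumes "1 \<le> e" "int e \<le> m" "a = \<lfloor>real K * (1 - recip_order (enat e))\<rfloor>"
  shows "m * a \<le> int K * (m - 1)"
proof -
  have "real_of_int m * of_int a \<le> m * (real K * (1 - 1 / real e))"
    using assms by (intro mult_left_mono) (simp_all add: recip_order_def)
  also have "\<dots> \<le> m * (real K * (1 - 1 / real_of_int m))"
    using assms by (intro mult_left_mono) (auto simp: frac_le)
  also have "\<dots> = real K * (m - 1)"
    using assms by (simp add: field_simps)
  finally have "real_of_int (m * a) \<le> real_of_int (int K * (m - 1))" by simp
  thus ?thesis by linarith
qed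

text \<open>The central estimate. It is stated for an arbitrary invariant function \<open>G\<close> because the
  ramification index at \<open>\<tau>\<close> is the order of \<open>F - F \<tau>\<close> when \<open>F\<close> is finite there, but minus the
  order of \<open>F\<close> at a pole.\<close>

lemma vertex_weights_over_point:
  assumes \<Gamma>: "subgroup \<Gamma> PSL2R" and v: "vertex_system \<Gamma> r t n" and w: "hauptmodul \<Gamma> w"
    and \<tau>: "\<tau> \<in> uhp"
    and G: "G meromorphic_on uhp" "\<And>x. x \<in> uhp \<Longrightarrow> eventually (\<lambda>y. G y \<noteq> 0) (at x)"
      "psl_invariant \<Gamma> G" "zorder G \<tau> \<noteq> 0"
    and a: "\<And>i. i \<in> {1..r} \<Longrightarrow> a i = \<lfloor>real K * (1 - recip_order (n i))\<rfloor>"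
  shows "\<bar>zorder G \<tau>\<bar> * (\<Sum>i | i \<in> {1..r} \<and> w (t i) = w (Some \<tau>). a i)
    \<le> int K * (\<bar>zorder G \<tau>\<bar> - 1)"
proof (cases "\<exists>i\<in>{1..r}. w (t i) = w (Some \<tau>)")
  case False
  hence "{i. i \<in> {1..r} \<and> w (t i) = w (Some \<tau>)} = {}" by auto
  hence "(\<Sum>i | i \<in> {1..r} \<and> w (t i) = w (Some \<tau>). a i) = 0" by (simp only: sum.empty)
  moreover have "1 \<le> \<bar>zorder G \<tau>\<bar>" using G(4) by simp
  ultimately show ?thesis by simp
next
  case True
  then obtain i where i: "i \<in> {1..r}" "w (t i) = w (Some \<tau>)" by blast
  have "{i. i \<in> {1..r} \<and> w (t i) = w (Some \<tau>)} = {i}"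
    using i vertex_values_distinct[OF \<Gamma> v w] by (auto simp del: atLeastAtMost_iff)
  hence sum: "(\<Sum>i | i \<in> {1..r} \<and> w (t i) = w (Some \<tau>). a i) = a i" by simp
  have ti: "t i \<in> elliptic_points \<Gamma> \<union> cusps \<Gamma>" "n i = vertex_order \<Gamma> (t i)"
    using v i(1) by (auto simp: vertex_system_def)
  have "Orb \<Gamma> (t i) = Orb \<Gamma> (Some \<tau>)"
    using ti(1) elliptic_points_subset[of \<Gamma>] \<tau> i(2)
    by (intro hauptmodul_separates[OF w]) (auto simp: uhp_star_def)
  hence "t i \<in> Orb \<Gamma> (Some \<tau>)" using identity_mem_orbit[OF \<Gamma>, of "t i"] by simp
  then obtain \<sigma> where \<sigma>: "t i = Some \<sigma>" "\<sigma> \<in> uhp" "zorder G \<sigma> = zorder G \<tau>"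
    using zorder_orbit[OF \<Gamma> \<tau> _ G(1-3)] by metis
  have "n i = enat (card (Stab \<Gamma> (Some \<sigma>)))"
    using ti(2) \<sigma>(1) cusp_notin_uhp[OF \<sigma>(2)] by (simp add: vertex_order_def)
  moreover have "G meromorphic_on {\<sigma>}" using G(1) \<sigma>(2) by (auto intro: meromorphic_on_subset)
  note card_stabilizer_le_zorder[OF \<Gamma> \<sigma>(2) this G(2)[OF \<sigma>(2)] G(3)]
  ultimately show ?thesis
    unfolding sum using a[OF i(1)] \<sigma>(3) G(4) by (intro floor_vertex_weight) auto
qed

section \<open>Holomorphy\<close>

text \<open>The bound on \<open>j\<close> is \<open>j \<le> d - 1\<close> rewritten with \<open>k = 2 K\<close>. Its purpose is to limit
  how far the power \<open>F ^ j\<close> lowers the order at a pole of \<open>F\<close>.\<close>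

lemma zorder_candidate_form_nonneg:
  fixes a :: "nat \<Rightarrow> int" and K :: nat
  assumes \<Gamma>: "subgroup \<Gamma> PSL2R" and v: "vertex_system \<Gamma> r t n" and w: "hauptmodul \<Gamma> w"
    and \<tau>: "\<tau> \<in> uhp"
    and a: "\<And>i. i \<in> {1..r} \<Longrightarrow> a i = \<lfloor>real K * (1 - recip_order (n i))\<rfloor>"
    and j: "int j \<le> (\<Sum>i=1..r. a i) - 2 * int K"
  defines "F \<equiv> finite_part w"
  shows "zorder (\<lambda>x. deriv F x ^ K * F x ^ j /
      (\<Prod>i | i \<in> {1..r} \<and> w (t i) \<noteq> None. (F x - the (w (t i))) powi a i)) \<tau> \<ge> 0"
proof -
  define I where "I = {i. i \<in> {1..r} \<and> w (t i) \<noteq> None}"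
  define S where "S = {i. i \<in> {1..r} \<and> w (t i) = w (Some \<tau>)}"
  have fin: "finite I" "finite S" by (simp_all add: I_def S_def)
  have nc: "eventually (\<lambda>x. F x \<noteq> c) (at x)" if "x \<in> uhp" for x c
    unfolding F_def by (rule hauptmodul_nonconstant[OF v w that])
  have nice: "F nicely_meromorphic_on uhp" 
    and pole: "w (Some \<tau>) = None \<longleftrightarrow> is_pole F \<tau>"
    using w \<tau> by (auto simp: hauptmodul_def F_def)
  hence mero: "F meromorphic_on uhp" by (simp add: nicely_meromorphic_on_def)
  have mero\<tau>: "F meromorphic_on {\<tau>}" using mero \<tau> by (auto intro: meromorphic_on_subset)
  have inv: "psl_invariant \<Gamma> F" unfolding F_def by (rule hauptmodul_invariant[OF \<Gamma> w])
  have fr: "frequently P (at \<tau>)" if "eventually P (at \<tau>)" for P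
    using that by (simp add: eventually_frequently)
  have "zorder (\<lambda>x. deriv F x ^ K * F x ^ j / (\<Prod>i\<in>I. (F x - the (w (t i))) powi a i)) \<tau> \<ge> 0"
  proof (cases "is_pole F \<tau>")
    case True
    define m where "m = - zorder F \<tau>"
    have m: "m > 0"
      using isolated_pole_imp_neg_zorder[OF meromorphic_on_isolated_singularity[OF mero\<tau>] True]
      by (simp add: m_def)
    have d: "eventually (\<lambda>x. deriv F x \<noteq> 0) (at \<tau>)" "zorder (deriv F) \<tau> = - m - 1"
      using deriv_eventually_nonzero[OF mero\<tau> nc[OF \<tau>]] m mero\<tau>
        zorder_deriv_minus_1[OF meromorphic_on_isolated_singularity[OF mero\<tau>]
          meromorphic_on_not_essential[OF mero\<tau>] fr[OF nc[OF \<tau>]]]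
      by (auto simp: m_def)
    \<comment> \<open>Subtracting a constant does not affect the order of a pole.\<close>
    have shift: "zorder (\<lambda>x. F x - c) \<tau> = - m" for c
    proof (cases "c = 0")
      case False
      have "zorder (\<lambda>x. F x - c) \<tau> = zorder F \<tau>"
        using mero\<tau> nc[OF \<tau>] False m
        by (intro zorder_diff1 meromorphic_intros fr) (auto simp: m_def)
      thus ?thesis by (simp add: m_def)
    qed (simp add: m_def)
    have "m * (\<Sum>i\<in>S. a i) \<le> int K * (m - 1)"
      using vertex_weights_over_point[OF \<Gamma> v w \<tau> mero nc inv _ a] m
      by (simp add: S_def m_def)
    moreover have "(\<Sum>i=1..r. a i) = (\<Sum>i\<in>S. a i) + (\<Sum>i\<in>I. a i)"
    proof -
      \<comment> \<open>At a pole, \<open>w(\<tau>) = \<infinity>\<close>, so the vertices missing from the denominator are exactly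
        those over \<open>w(\<tau>)\<close>.\<close>
      have "{1..r} = S \<union> I" "S \<inter> I = {}" using pole True by (auto simp: S_def I_def)
      thus ?thesis using fin by (simp add: sum.union_disjoint)
    qed
    moreover have "m * int j \<le> m * ((\<Sum>i=1..r. a i) - 2 * int K)"
      using j m by (intro mult_left_mono) auto
    ultimately have "int K * (- m - 1) + int j * (- m) - (\<Sum>i\<in>I. a i * (- m)) \<ge> 0"
      by (simp add: algebra_simps sum_negf flip: sum_distrib_left sum_distrib_right)
    thus ?thesis
      using zorder_candidate_form[OF mero\<tau> nc[OF \<tau>] d(1) fin(1) nc[OF \<tau>],
          where b = "\<lambda>i. the (w (t i))" and K = K and j = j and a = a]
      unfolding shift d(2) by (simp add: m_def)
  next
    case False
    have an: "F analytic_on {\<tau>}"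
      using nicely_meromorphic_on_imp_analytic_at[OF nice \<tau> False] .
    define G where "G x = F x - F \<tau>" for x
    have Gmero: "G meromorphic_on uhp" unfolding G_def using mero by (intro meromorphic_intros)
    have G\<tau>: "G meromorphic_on {\<tau>}" using Gmero \<tau> by (auto intro: meromorphic_on_subset)
    have Gnz: "eventually (\<lambda>y. G y \<noteq> 0) (at x)" if "x \<in> uhp" for x
      using nc[OF that, of "F \<tau>"] by (simp add: G_def)
    have Ginv: "psl_invariant \<Gamma> G" using inv by (simp add: psl_invariant_def G_def)
    define m where "m = zorder G \<tau>"
    have m: "m > 0"
    proof -
      have "G analytic_on {\<tau>}" unfolding G_def[abs_def] using an by (intro analytic_intros)
      thus ?thesis
        unfolding m_def using zorder_pos_iff'[OF _ fr[OF Gnz[OF \<tau>]]] G_def[of \<tau>] by simp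
    qed
    have "deriv G x = deriv F x" for x
      unfolding deriv_def by (simp add: has_field_derivative_iff G_def)
    hence dG: "deriv G = deriv F" by auto
    have d: "eventually (\<lambda>x. deriv F x \<noteq> 0) (at \<tau>)" "zorder (deriv F) \<tau> = m - 1"
      using deriv_eventually_nonzero[OF G\<tau> Gnz[OF \<tau>]] m
        zorder_deriv_minus_1[OF meromorphic_on_isolated_singularity[OF G\<tau>]
          meromorphic_on_not_essential[OF G\<tau>] fr[OF Gnz[OF \<tau>]]]
      by (auto simp: m_def dG)
    have w\<tau>: "w (Some \<tau>) = Some (F \<tau>)"
      using pole False by (auto simp: F_def finite_part_def)
    have shift: "zorder (\<lambda>x. F x - the (w (t i))) \<tau> = (if i \<in> S then m else 0)" if "i \<in> I" for i
    proof (cases "i \<in> S")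
      case True
      thus ?thesis by (simp add: S_def w\<tau> m_def G_def[abs_def])
    next
      case False
      hence "F \<tau> - the (w (t i)) \<noteq> 0" using that by (auto simp: S_def I_def w\<tau>)
      thus ?thesis using False an
        by (auto intro!: zorder_eq_0I analytic_intros)
    qed
    have "S \<subseteq> I" by (auto simp: S_def I_def w\<tau>)
    have "(\<Sum>i\<in>I. a i * zorder (\<lambda>x. F x - the (w (t i))) \<tau>) = (\<Sum>i\<in>I. if i \<in> S then a i * m else 0)"
      by (intro sum.cong) (auto simp: shift)
    also have "\<dots> = m * (\<Sum>i\<in>S. a i)"
      using \<open>S \<subseteq> I\<close> fin by (simp add: sum.If_cases Int_absorb1 sum_distrib_left mult.commute)
    also have "\<dots> \<le> int K * (m - 1)"
      using vertex_weights_over_point[OF \<Gamma> v w \<tau> Gmero Gnz Ginv _ a] m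
      by (simp add: S_def m_def)
    finally have "(\<Sum>i\<in>I. a i * zorder (\<lambda>x. F x - the (w (t i))) \<tau>) \<le> int K * (m - 1)" .
    moreover have "int j * zorder F \<tau> \<ge> 0"
      using zorder_ge_0[OF an fr[OF nc[OF \<tau>]]] by simp
    ultimately show ?thesis
      using zorder_candidate_form[OF mero\<tau> nc[OF \<tau>] d(1) fin(1) nc[OF \<tau>],
          where b = "\<lambda>i. the (w (t i))" and K = K and j = j and a = a]
      unfolding d(2) by simp
  qed
  thus ?thesis
    by (simp add: I_def)
qed

theorem theorem2:
  fixes \<Gamma> :: "(real^2^2) set set"
    and r k :: nat
    and n :: "nat \<Rightarrow> enat"
    and t :: "nat \<Rightarrow> complex option"
    and w :: "complex option \<Rightarrow> complex option"
    and a :: "nat \<Rightarrow> int"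
    and d :: int
    and h :: "nat \<Rightarrow> complex \<Rightarrow> complex"
  assumes "fuchsian \<Gamma>"
    and "compact_space (quotient_space \<Gamma>)"
    and "has_signature \<Gamma> 0 r n"
    and "vertex_system \<Gamma> r t n"
    and "hauptmodul \<Gamma> w"
    and "k \<ge> 4" and "even k"
    and "\<And>i. i \<in> {1..r} \<Longrightarrow> a i = \<lfloor>real k / 2 * (1 - recip_order (n i))\<rfloor>"
    and "d = 1 - int k + (\<Sum>i=1..r. a i)"
    and "\<And>j \<tau>. int j \<le> d - 1 \<Longrightarrow> \<tau> \<in> uhp \<Longrightarrow>
           h j \<tau> = deriv (finite_part w) \<tau> ^ (k div 2) * finite_part w \<tau> ^ j /
             (\<Prod>i | i \<in> {1..r} \<and> w (t i) \<noteq> None.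
                (finite_part w \<tau> - the (w (t i))) powi a i)"
  shows "\<forall>j. int j \<le> d - 1 \<longrightarrow>
           h j meromorphic_on uhp \<and> (\<forall>\<tau>\<in>uhp. \<not> is_pole (h j) \<tau>)"
proof (intro allI impI)
  fix j assume j: "int j \<le> d - 1"
  have \<Gamma>: "subgroup \<Gamma> PSL2R" using assms(1) by (simp add: fuchsian_def)
  define F where "F = finite_part w"
  define K where "K = k div 2"
  have k: "k = 2 * K" using assms(7) by (simp add: K_def)
  have a: "a i = \<lfloor>real K * (1 - recip_order (n i))\<rfloor>" if "i \<in> {1..r}" for i
    using assms(8)[OF that] by (simp add: k)
  have jK: "int j \<le> (\<Sum>i=1..r. a i) - 2 * int K" using j assms(9) by (simp add: k)
  define H where "H x = deriv F x ^ K * F x ^ j /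
      (\<Prod>i | i \<in> {1..r} \<and> w (t i) \<noteq> None. (F x - the (w (t i))) powi a i)" for x
  have "F meromorphic_on uhp"
    using assms(5) by (simp add: hauptmodul_def nicely_meromorphic_on_def F_def)
  hence H: "H meromorphic_on uhp" unfolding H_def[abs_def] by (intro meromorphic_intros)
  have eq: "eventually (\<lambda>x. h j x = H x) (at \<tau>)" if "\<tau> \<in> uhp" for \<tau>
    using eventually_uhp[OF that]
    by eventually_elim (use assms(10)[OF j] in \<open>simp add: H_def F_def K_def\<close>)
  have "h j meromorphic_on uhp"
    using meromorphic_on_cong[OF eq refl] H by blast
  moreover have "\<not> is_pole (h j) \<tau>" if \<tau>: "\<tau> \<in> uhp" for \<tau>
  proof -
    have "H meromorphic_on {\<tau>}" using H \<tau> by (auto intro: meromorphic_on_subset)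
    hence "\<not> is_pole H \<tau>"
      using zorder_candidate_form_nonneg[OF \<Gamma> assms(4,5) \<tau> a jK]
        isolated_pole_imp_neg_zorder[OF meromorphic_on_isolated_singularity, of H \<tau>]
      unfolding H_def[abs_def] F_def by fastforce
    thus ?thesis using is_pole_cong[OF eq[OF \<tau>] refl] by simp
  qed
  ultimately show "h j meromorphic_on uhp \<and> (\<forall>\<tau>\<in>uhp. \<not> is_pole (h j) \<tau>)" by blast
qed

end
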